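(* A Boolean combination $\varphi$ of core formulae is valid if and only if $\vdash_{\mathsf{C}}\varphi$.
   Context: Let $\mathrm{PVAR}$ be a countably infinite set of program variables and $\mathrm{LOC}$ a countably infinite set of locations. A memory state is a pair $(s,h)$ with $s:\mathrm{PVAR}\to\mathrm{LOC}$ and $h:\mathrm{LOC}\to\mathrm{LOC}$ a partial function with finite domain $\mathrm{dom}(h)$. Formulae of separation logic $\mathrm{SL}( *,-\!* )$: $\varphi ::= x=y \mid x\hookrightarrow y \mid \mathrm{emp} \mid \neg\varphi \mid \varphi\wedge\varphi \mid \varphi*\varphi \mid \varphi -\!* \varphi$, with the standard heaplet semantics ($x\hookrightarrow y$: $s(x)\in\mathrm{dom}(h)$ and $h(s(x))=s(y)$; $\mathrm{emp}$: empty heap; $*$: split of the heap into two disjoint heaps satisfying the two sides; $\varphi-\!*\psi$: every disjoint extension satisfying $\varphi$ gives a heap satisfying $\psi$). Valid means satisfied by all memory states. Abbreviations: $\bot:=\neg(x=x)$, $\top:=\neg\bot$, $x\neq y:=\neg(x=y)$, $\mathrm{alloc}(x):=(x\hookrightarrow x)-\!*\bot$ (holds iff $s(x)\in\mathrm{dom}(h)$), $\mathrm{size}\geq0:=\top$, $\mathrm{size}\geq1:=\neg\mathrm{emp}$, $\mathrm{size}\geq\beta+2:=\neg\mathrm{emp}*\mathrm{size}\geq\beta+1$ (holds iff $|\mathrm{dom}(h)|\geq\beta$). Core formulae are the formulae $x=y$, $\mathrm{alloc}(x)$, $x\hookrightarrow y$, $\mathrm{size}\geq\beta$ ($x,y\in\mathrm{PVAR}$,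 $\beta\in\mathbb{N}$). The Hilbert-style system $\mathsf{C}$ consists of all instances of propositional tautologies, modus ponens, and the axiom schemata (with $\varphi$ ranging over formulae, $x,y,z$ over program variables, $\beta$ over naturals, $X$ over finite sets of variables, and $\varphi[y\leftarrow x]$ the replacement of every occurrence of $y$ by $x$): $x=x$; $\varphi\wedge x=y\Rightarrow\varphi[y\leftarrow x]$; $x\hookrightarrow y\Rightarrow\mathrm{alloc}(x)$; $x\hookrightarrow y\wedge x\hookrightarrow z\Rightarrow y=z$; $\mathrm{size}\geq\beta+1\Rightarrow\mathrm{size}\geq\beta$; $\bigwedge_{x\in X}(\mathrm{alloc}(x)\wedge\bigwedge_{y\in X\setminus\{x\}}x\neq y)\Rightarrow\mathrm{size}\geq|X|$. $\vdash_{\mathsf{C}}\varphi$ means $\varphi$ is derivable. *)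

theory Defs
  imports "HOL-Library.Finite_Map" "HOL-Library.Countable" "HOL-Library.Infinite_Typeclass"
begin

datatype 'v form =
    Eq 'v 'v
  | PointsTo 'v 'v
  | Emp
  | Neg "'v form"
  | And "'v form" "'v form"
  | Star "'v form" "'v form"
  | Wand "'v form" "'v form"

(* Heaps are finite maps, so every pair (s, h) of these types is a memory state. *)
primrec sat :: "('v \<Rightarrow> 'l) \<Rightarrow> ('l, 'l) fmap \<Rightarrow> 'v form \<Rightarrow> bool" where
  "sat s h (Eq x y) \<longleftrightarrow> s x = s y"
| "sat s h (PointsTo x y) \<longleftrightarrow> fmlookup h (s x) = Some (s y)"
| "sat s h Emp \<longleftrightarrow> h = fmempty"
| "sat s h (Neg \<phi>) \<longleftrightarrow> \<not> sat s h \<phi>"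
| "sat s h (And \<phi> \<psi>) \<longleftrightarrow> sat s h \<phi> \<and> sat s h \<psi>"
| "sat s h (Star \<phi> \<psi>) \<longleftrightarrow>
     (\<exists>h1 h2. fmdom' h1 \<inter> fmdom' h2 = {} \<and> h = h1 ++\<^sub>f h2 \<and> sat s h1 \<phi> \<and> sat s h2 \<psi>)"
| "sat s h (Wand \<phi> \<psi>) \<longleftrightarrow>
     (\<forall>h'. fmdom' h \<inter> fmdom' h' = {} \<and> sat s h' \<phi> \<longrightarrow> sat s (h ++\<^sub>f h') \<psi>)"

(* The type of locations does not occur in formulae and is passed explicitly. *)
definition valid :: "'l itself \<Rightarrow> 'v form \<Rightarrow> bool" where
  "valid L \<phi> \<longleftrightarrow> (\<forall>(s :: 'v \<Rightarrow> 'l) h. sat s h \<phi>)"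

definition Imp :: "'v form \<Rightarrow> 'v form \<Rightarrow> 'v form" where
  "Imp \<phi> \<psi> = Neg (And \<phi> (Neg \<psi>))"

(* Bottom is a single formula, built from one fixed but unspecified variable. *)
definition Bot :: "'v form" where
  "Bot = (let x = (SOME x. True) in Neg (Eq x x))"

definition Top :: "'v form" where
  "Top = Neg Bot"

definition Alloc :: "'v \<Rightarrow> 'v form" where
  "Alloc x = Wand (PointsTo x x) Bot"

fun SizeGe :: "nat \<Rightarrow> 'v form" where
  "SizeGe 0 = Top"
| "SizeGe (Suc 0) = Neg Emp"
| "SizeGe (Suc (Suc \<beta>)) = Star (Neg Emp) (SizeGe (Suc \<beta>))"

inductive core :: "'v form \<Rightarrow> bool" where
  "core (Eq x y)"
| "core (Alloc x)"
| "core (PointsTo x y)"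
| "core (SizeGe \<beta>)"

inductive boolean_combination :: "('v form \<Rightarrow> bool) \<Rightarrow> 'v form \<Rightarrow> bool"
  for P :: "'v form \<Rightarrow> bool" where
  "P \<phi> \<Longrightarrow> boolean_combination P \<phi>"
| "boolean_combination P \<phi> \<Longrightarrow> boolean_combination P (Neg \<phi>)"
| "boolean_combination P \<phi> \<Longrightarrow> boolean_combination P \<psi> \<Longrightarrow> boolean_combination P (And \<phi> \<psi>)"

datatype prop_form = PAtom nat | PNeg prop_form | PAnd prop_form prop_form

primrec prop_eval :: "(nat \<Rightarrow> bool) \<Rightarrow> prop_form \<Rightarrow> bool" where
  "prop_eval v (PAtom i) \<longleftrightarrow> v i"
| "prop_eval v (PNeg p) \<longleftrightarrow> \<not> prop_eval v p"
| "prop_eval v (PAnd p q) \<longleftrightarrow> prop_eval v p \<and> prop_eval v q"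

definition tautology :: "prop_form \<Rightarrow> bool" where
  "tautology p \<longleftrightarrow> (\<forall>v. prop_eval v p)"

primrec prop_inst :: "(nat \<Rightarrow> 'v form) \<Rightarrow> prop_form \<Rightarrow> 'v form" where
  "prop_inst \<sigma> (PAtom i) = \<sigma> i"
| "prop_inst \<sigma> (PNeg p) = Neg (prop_inst \<sigma> p)"
| "prop_inst \<sigma> (PAnd p q) = And (prop_inst \<sigma> p) (prop_inst \<sigma> q)"

(* Replaces every occurrence of y by x (in this argument order). *)
definition subst :: "'v form \<Rightarrow> 'v \<Rightarrow> 'v \<Rightarrow> 'v form" where
  "subst \<phi> y x = map_form (\<lambda>z. if z = y then x else z) \<phi>"

definition BigAnd :: "'v form list \<Rightarrow> 'v form" where
  "BigAnd \<phi>s = foldr And \<phi>s Top"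

(* In the last axiom the finite set X is given by an arbitrary repetition-free
   enumeration xs, so that |X| = length xs and the conjunctions over X and X - {x}
   are taken in the order of xs. *)
inductive derivable :: "'v form \<Rightarrow> bool" (\<open>\<turnstile>\<^sub>C _\<close> [51] 50) where
  taut: "tautology p \<Longrightarrow> \<turnstile>\<^sub>C prop_inst \<sigma> p"
| mp: "\<turnstile>\<^sub>C Imp \<phi> \<psi> \<Longrightarrow> \<turnstile>\<^sub>C \<phi> \<Longrightarrow> \<turnstile>\<^sub>C \<psi>"
| eq_refl: "\<turnstile>\<^sub>C Eq x x"
| eq_subst: "\<turnstile>\<^sub>C Imp (And \<phi> (Eq x y)) (subst \<phi> y x)"
| points_to_alloc: "\<turnstile>\<^sub>C Imp (PointsTo x y) (Alloc x)"
| points_to_functional: "\<turnstile>\<^sub>C Imp (And (PointsTo x y) (PointsTo x z)) (Eq y z)"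
| size_mono: "\<turnstile>\<^sub>C Imp (SizeGe (\<beta> + 1)) (SizeGe \<beta>)"
| alloc_size: "distinct xs \<Longrightarrow>
    \<turnstile>\<^sub>C Imp (BigAnd (map (\<lambda>x. And (Alloc x) (BigAnd (map (\<lambda>y. Neg (Eq x y)) (removeAll x xs)))) xs))
           (SizeGe (length xs))"

end

theory Submission
  imports Defs
begin

text \<open>
  Completeness is a Lindenbaum argument. An underivable formula is falsified by a Boolean valuation
  of formulae that makes every theorem true. Under such a valuation, equality is a congruence on
  variables, so the finitely many atoms of the formula can be realised: locations are classes of
  variables, \<open>h\<close> is read off the points-to atoms (allocated variables without a named
  successor point to a fresh location), and fresh cells are added to the heap until it has the
  largest size, up to a sufficiently large bound, that the valuation asserts. The last axiom
  guarantees that the named cells do not already exceed that size.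
\<close>

section \<open>Semantics of the core formulae\<close>

lemma sat_Bot [simp]: "\<not> sat s h Bot"
  by (simp add: Bot_def Let_def)

lemma sat_Top [simp]: "sat s h Top"
  by (simp add: Top_def)

lemma sat_Imp [simp]: "sat s h (Imp \<phi> \<psi>) \<longleftrightarrow> (sat s h \<phi> \<longrightarrow> sat s h \<psi>)"
  by (simp add: Imp_def)

lemma sat_BigAnd [simp]: "sat s h (BigAnd \<phi>s) \<longleftrightarrow> (\<forall>\<phi>\<in>set \<phi>s. sat s h \<phi>)"
  by (induction \<phi>s) (simp_all add: BigAnd_def)

text \<open>If \<open>s x\<close> is allocated, no disjoint heap satisfies
  \<open>PointsTo x x\<close>, so the wand holds vacuously. Otherwise the one-cell heap from
  \<open>s x\<close> to itself is a disjoint extension, which would have to satisfy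
  \<open>Bot\<close>.\<close>

lemma sat_Alloc [simp]: "sat s h (Alloc x) \<longleftrightarrow> s x \<in> fmdom' h"
proof
  show "sat s h (Alloc x)" if "s x \<in> fmdom' h"
    using that by (auto simp: Alloc_def intro: fmdom'I)
next
  assume "sat s h (Alloc x)"
  then show "s x \<in> fmdom' h"
    by (auto simp: Alloc_def dest!: spec[of _ "fmupd (s x) (s x) fmempty"])
qed

lemma finite_fmdom' [simp]: "finite (fmdom' h)"
  by (simp add: fmdom'_alt_def)

lemma fmdom'_eq_empty_iff [simp]: "fmdom' h = {} \<longleftrightarrow> h = fmempty"
  by (metis fmdom'_empty fmdom'_notI fmdom'_notD fmap_ext equals0D fmempty_lookup equals0I)

lemma sat_SizeGe [simp]: "sat s h (SizeGe \<beta>) \<longleftrightarrow> \<beta> \<le> card (fmdom' h)"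
proof (induction \<beta> arbitrary: h rule: SizeGe.induct)
  case 1
  show ?case by simp
next
  case 2
  show ?case by (simp add: Suc_le_eq card_gt_0_iff)
next
  case (3 \<beta>)
  show ?case
  proof
    assume "sat s h (SizeGe (Suc (Suc \<beta>)))"
    then obtain h1 h2 where h: "fmdom' h1 \<inter> fmdom' h2 = {}" "h = h1 ++\<^sub>f h2" "h1 \<noteq> fmempty"
        and h2: "Suc \<beta> \<le> card (fmdom' h2)"
      by (auto simp: 3)
    have "card (fmdom' h1) \<noteq> 0"
      using h(3) by simp
    moreover have "card (fmdom' h) = card (fmdom' h1) + card (fmdom' h2)"
      using h by (simp add: card_Un_disjoint)
    ultimately show "Suc (Suc \<beta>) \<le> card (fmdom' h)"
      using h2 by linarith
  next
    assume large: "Suc (Suc \<beta>) \<le> card (fmdom' h)"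
    then obtain l where l: "l \<in> fmdom' h"
      by (metis card.empty equals0I not_less_eq_eq zero_le)
    \<comment> \<open>Splitting off exactly one cell leaves as much as possible for the second
      conjunct.\<close>
    let ?h1 = "fmrestrict_set {l} h" and ?h2 = "fmdrop l h"
    have "fmdom' ?h1 \<inter> fmdom' ?h2 = {}"
      by (auto simp: fmlookup_dom'_iff split: if_splits)
    moreover have "h = ?h1 ++\<^sub>f ?h2"
      by (rule fmap_ext) auto
    moreover have "?h1 \<noteq> fmempty"
      using l by (metis fmdom'_notD fmempty_lookup fmlookup_restrict_set fmdom'_notI singletonI)
    moreover have "Suc \<beta> \<le> card (fmdom' ?h2)"
      using large l by simp
    ultimately show "sat s h (SizeGe (Suc (Suc \<beta>)))"
      unfolding SizeGe.simps sat.simps 3 by blast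
  qed
qed

section \<open>Soundness\<close>

lemma sat_map_form: "sat s h (map_form f \<phi>) \<longleftrightarrow> sat (s \<circ> f) h \<phi>"
  by (induction \<phi> arbitrary: h) auto

lemma sat_subst:
  assumes "s x = s y"
  shows "sat s h (subst \<phi> y x) \<longleftrightarrow> sat s h \<phi>"
proof -
  have "s \<circ> (\<lambda>z. if z = y then x else z) = s"
    using assms by auto
  then show ?thesis
    by (simp add: subst_def sat_map_form)
qed

lemma sat_prop_inst: "sat s h (prop_inst \<sigma> p) \<longleftrightarrow> prop_eval (\<lambda>i. sat s h (\<sigma> i)) p"
  by (induction p) auto

lemma derivable_sound: "\<turnstile>\<^sub>C \<phi> \<Longrightarrow> sat s h \<phi>"
proof (induction rule: derivable.induct)
  case (taut p \<sigma>)
  then show ?case by (simp add: sat_prop_inst tautology_def)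
next
  case (alloc_size xs)
  have "length xs \<le> card (fmdom' h)"
    if *: "\<forall>x\<in>set xs. s x \<in> fmdom' h \<and> (\<forall>y\<in>set xs - {x}. s x \<noteq> s y)"
  proof -
    \<comment> \<open>The pairwise disequalities become injectivity of the store, so counting
      variables counts allocated cells.\<close>
    have "inj_on s (set xs)"
      using * by (auto intro!: inj_onI)
    then have "length xs = card (s ` set xs)"
      using alloc_size by (simp add: card_image distinct_card)
    also have "\<dots> \<le> card (fmdom' h)"
      using * by (intro card_mono) auto
    finally show ?thesis .
  qed
  then show ?case by simp
qed (auto simp: sat_subst intro: fmdom'I)

section \<open>Boolean valuations\<close>

text \<open>The numbering of formulae serves twice: as names of atoms in \<open>skeleton\<close> and
  as the enumeration in \<open>lindenbaum\<close>.\<close>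

instance form :: (countable) countable
  by countable_datatype

locale boolean_valuation =
  fixes e :: "'v form \<Rightarrow> bool"
  assumes Neg [simp]: "e (Neg \<phi>) \<longleftrightarrow> \<not> e \<phi>"
    and And [simp]: "e (And \<phi> \<psi>) \<longleftrightarrow> e \<phi> \<and> e \<psi>"
begin

lemma Imp [simp]: "e (Imp \<phi> \<psi>) \<longleftrightarrow> (e \<phi> \<longrightarrow> e \<psi>)"
  by (simp add: Imp_def)

end

fun skeleton :: "'v :: countable form \<Rightarrow> prop_form" where
  "skeleton (Neg \<phi>) = PNeg (skeleton \<phi>)"
| "skeleton (And \<phi> \<psi>) = PAnd (skeleton \<phi>) (skeleton \<psi>)"
| "skeleton \<phi> = PAtom (to_nat \<phi>)"

lemma prop_inst_skeleton: "prop_inst from_nat (skeleton \<phi>) = \<phi>"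
  by (induction \<phi> rule: skeleton.induct) simp_all

text \<open>Composing a propositional valuation with \<open>skeleton\<close> gives a Boolean
  valuation, so the skeleton is a tautology, and decoding its atoms gives back the formula.
  Truth-functional reasoning inside the calculus is thereby left to the simplifier.\<close>

lemma derivable_if_boolean_valid:
  fixes \<phi> :: "'v :: countable form"
  assumes "\<And>e. boolean_valuation e \<Longrightarrow> e \<phi>"
  shows "\<turnstile>\<^sub>C \<phi>"
proof -
  have "tautology (skeleton \<phi>)"
    unfolding tautology_def
  proof
    fix v
    have "boolean_valuation (\<lambda>\<psi> :: 'v form. prop_eval v (skeleton \<psi>))"
      by unfold_locales simp_all
    then show "prop_eval v (skeleton \<phi>)"
      by (rule assms)
  qed
  then show ?thesis
    using taut[of "skeleton \<phi>" "from_nat :: nat \<Rightarrow> 'v form"] by (simp add: prop_inst_skeleton)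
qed

lemma derivable_consequence:
  fixes \<phi> :: "'v :: countable form"
  assumes "\<turnstile>\<^sub>C \<phi>" "\<And>e. boolean_valuation e \<Longrightarrow> e \<phi> \<Longrightarrow> e \<psi>"
  shows "\<turnstile>\<^sub>C \<psi>"
  by (rule mp[OF derivable_if_boolean_valid assms(1)]) (simp add: boolean_valuation.Imp assms(2))

lemma derivable_consequence2:
  fixes \<phi> :: "'v :: countable form"
  assumes "\<turnstile>\<^sub>C \<phi>" "\<turnstile>\<^sub>C \<psi>" "\<And>e. boolean_valuation e \<Longrightarrow> e \<phi> \<Longrightarrow> e \<psi> \<Longrightarrow> e \<chi>"
  shows "\<turnstile>\<^sub>C \<chi>"
  by (rule mp[OF mp[OF derivable_if_boolean_valid assms(1)] assms(2)])
    (simp add: boolean_valuation.Imp assms(3))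

section \<open>Maximal consistent sets, as valuations, and the Lindenbaum construction\<close>

locale theory_valuation = boolean_valuation e for e :: "'v form \<Rightarrow> bool" +
  assumes derivable: "\<turnstile>\<^sub>C \<phi> \<Longrightarrow> e \<phi>"

text \<open>A stage is the conjunction of all decisions made so far, so its consistency is the
  underivability of a single negation.\<close>

primrec lindenbaum :: "'v :: countable form \<Rightarrow> nat \<Rightarrow> 'v form" where
  "lindenbaum \<phi> 0 = \<phi>"
| "lindenbaum \<phi> (Suc n) =
    (let \<psi> = And (lindenbaum \<phi> n) (from_nat n)
     in if \<turnstile>\<^sub>C Neg \<psi> then And (lindenbaum \<phi> n) (Neg (from_nat n)) else \<psi>)"

text \<open>If both ways of deciding the next formula were refutable, the preceding stage would
  already be refutable.\<close>

lemma lindenbaum_consistent: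
  assumes "\<not> \<turnstile>\<^sub>C Neg \<phi>"
  shows "\<not> \<turnstile>\<^sub>C Neg (lindenbaum \<phi> n)"
proof (induction n)
  case (Suc n)
  let ?T = "lindenbaum \<phi> n"
  have False
    if "\<turnstile>\<^sub>C Neg (And ?T (from_nat n))" "\<turnstile>\<^sub>C Neg (And ?T (Neg (from_nat n)))"
  proof -
    have "\<turnstile>\<^sub>C Neg ?T"
      by (rule derivable_consequence2[OF that])
        (auto simp: boolean_valuation.Neg boolean_valuation.And)
    with Suc show False ..
  qed
  then show ?case
    by (auto simp: Let_def)
qed (use assms in simp)

lemma lindenbaum_mono:
  assumes "m \<le> n"
  shows "\<turnstile>\<^sub>C Imp (lindenbaum \<phi> n) (lindenbaum \<phi> m)"
  using assms
proof (induction rule: dec_induct)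
  case base
  show ?case
    by (rule derivable_if_boolean_valid) (simp add: boolean_valuation.Imp)
next
  case (step n)
  show ?case
    by (rule derivable_consequence[OF step.IH])
      (auto simp: boolean_valuation.Imp boolean_valuation.And Let_def split: if_splits)
qed

lemma lindenbaum_weaken:
  assumes "\<turnstile>\<^sub>C Imp (lindenbaum \<phi> m) \<psi>" "m \<le> n"
  shows "\<turnstile>\<^sub>C Imp (lindenbaum \<phi> n) \<psi>"
  by (rule derivable_consequence2[OF assms(1) lindenbaum_mono[OF assms(2)]])
    (auto simp: boolean_valuation.Imp)

lemma lindenbaum_decides:
  "\<exists>n. \<turnstile>\<^sub>C Imp (lindenbaum \<phi> n) \<psi> \<or> \<turnstile>\<^sub>C Imp (lindenbaum \<phi> n) (Neg \<psi>)"
proof -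
  let ?n = "to_nat \<psi>"
  have "\<turnstile>\<^sub>C Imp (lindenbaum \<phi> (Suc ?n)) \<psi> \<or> \<turnstile>\<^sub>C Imp (lindenbaum \<phi> (Suc ?n)) (Neg \<psi>)"
    by (auto simp: Let_def boolean_valuation.Imp boolean_valuation.And
        intro: derivable_if_boolean_valid)
  then show ?thesis ..
qed

lemma theory_valuation_exists:
  fixes \<phi> :: "'v :: countable form"
  assumes "\<not> \<turnstile>\<^sub>C Neg \<phi>"
  obtains e where "theory_valuation e" "e \<phi>"
proof -
  \<comment> \<open>Stages only get stronger, so facts obtained at two stages can be combined at the
    later one, \<open>max m n\<close>.\<close>
  define e where "e \<psi> \<longleftrightarrow> (\<exists>n. \<turnstile>\<^sub>C Imp (lindenbaum \<phi> n) \<psi>)" for \<psi>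
  have consistent: "\<not> (e \<psi> \<and> e (Neg \<psi>))" for \<psi>
  proof
    assume "e \<psi> \<and> e (Neg \<psi>)"
    then obtain m n where "\<turnstile>\<^sub>C Imp (lindenbaum \<phi> m) \<psi>" "\<turnstile>\<^sub>C Imp (lindenbaum \<phi> n) (Neg \<psi>)"
      unfolding e_def by blast
    then have "\<turnstile>\<^sub>C Imp (lindenbaum \<phi> (max m n)) \<psi>" "\<turnstile>\<^sub>C Imp (lindenbaum \<phi> (max m n)) (Neg \<psi>)"
      by (auto elim: lindenbaum_weaken)
    then have "\<turnstile>\<^sub>C Neg (lindenbaum \<phi> (max m n))"
      by (rule derivable_consequence2) (auto simp: boolean_valuation.Imp boolean_valuation.Neg)
    then show False
      using lindenbaum_consistent[OF assms] by blast
  qed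
  have consequence: "e \<chi>"
    if \<psi>: "e \<psi>" "e \<psi>'" and \<chi>: "\<And>e. boolean_valuation e \<Longrightarrow> e \<psi> \<Longrightarrow> e \<psi>' \<Longrightarrow> e \<chi>" for \<psi> \<psi>' \<chi>
  proof -
    obtain m n where "\<turnstile>\<^sub>C Imp (lindenbaum \<phi> m) \<psi>" "\<turnstile>\<^sub>C Imp (lindenbaum \<phi> n) \<psi>'"
      using \<psi> unfolding e_def by blast
    then have "\<turnstile>\<^sub>C Imp (lindenbaum \<phi> (max m n)) \<psi>" "\<turnstile>\<^sub>C Imp (lindenbaum \<phi> (max m n)) \<psi>'"
      by (auto elim: lindenbaum_weaken)
    then have "\<turnstile>\<^sub>C Imp (lindenbaum \<phi> (max m n)) \<chi>"
      by (rule derivable_consequence2) (simp add: boolean_valuation.Imp \<chi>)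
    then show ?thesis
      unfolding e_def by blast
  qed
  have "theory_valuation e"
  proof
    show Neg: "e (Neg \<psi>) \<longleftrightarrow> \<not> e \<psi>" for \<psi>
      using consistent lindenbaum_decides[of \<phi> \<psi>] unfolding e_def by blast
    show "e (And \<psi> \<chi>) \<longleftrightarrow> e \<psi> \<and> e \<chi>" for \<psi> \<chi>
    proof
      assume *: "e (And \<psi> \<chi>)"
      show "e \<psi> \<and> e \<chi>"
        using consequence[OF * *] by (simp add: boolean_valuation.And)
    next
      assume "e \<psi> \<and> e \<chi>"
      then show "e (And \<psi> \<chi>)"
        using consequence[of \<psi> \<chi>] by (simp add: boolean_valuation.And)
    qed
    show "e \<psi>" if "\<turnstile>\<^sub>C \<psi>" for \<psi>
    proof -
      have "\<turnstile>\<^sub>C Imp (lindenbaum \<phi> 0) \<psi>"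
        by (rule derivable_consequence[OF that]) (simp add: boolean_valuation.Imp)
      then show ?thesis
        unfolding e_def by blast
    qed
  qed
  moreover have "e \<phi>"
    unfolding e_def using lindenbaum_mono[of 0 0 \<phi>] by (auto intro: exI[of _ 0])
  ultimately show ?thesis
    by (rule that)
qed

lemma derivable_if_theory_valid:
  fixes \<phi> :: "'v :: countable form"
  assumes "\<And>e. theory_valuation e \<Longrightarrow> e \<phi>"
  shows "\<turnstile>\<^sub>C \<phi>"
proof (rule ccontr)
  assume "\<not> \<turnstile>\<^sub>C \<phi>"
  moreover have "\<turnstile>\<^sub>C \<phi>" if "\<turnstile>\<^sub>C Neg (Neg \<phi>)"
    by (rule derivable_consequence[OF that]) (simp add: boolean_valuation.Neg)
  ultimately obtain e where "theory_valuation e" "e (Neg \<phi>)"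
    using theory_valuation_exists[of "Neg \<phi>"] by blast
  then interpret theory_valuation e
    by simp
  show False
    using assms[OF theory_valuation_axioms] \<open>e (Neg \<phi>)\<close> by simp
qed

section \<open>Realising a valuation by a memory state\<close>

context theory_valuation
begin

lemma Top [simp]: "e Top"
  using derivable[OF eq_refl] by (simp add: Top_def Bot_def Let_def)

lemma BigAnd [simp]: "e (BigAnd \<phi>s) \<longleftrightarrow> (\<forall>\<phi>\<in>set \<phi>s. e \<phi>)"
  by (induction \<phi>s) (simp_all add: BigAnd_def)

text \<open>The axiom gives only one direction; its instance for \<open>Neg \<phi>\<close> gives the
  other by contraposition.\<close>

lemma subst_iff:
  assumes "e (Eq x y)"
  shows "e (subst \<phi> y x) \<longleftrightarrow> e \<phi>"
  using derivable[OF eq_subst[of \<phi> x y]] derivable[OF eq_subst[of "Neg \<phi>" x y]] assms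
  by (auto simp: subst_def)

text \<open>
  Since the axiom replaces all occurrences of a variable at once, replacing only some of them is
  done by comparing both formulae with their common total substitution instance.
\<close>

lemma eq_cong:
  assumes "e (Eq x y)" "subst \<phi> y x = subst \<psi> y x"
  shows "e \<phi> \<longleftrightarrow> e \<psi>"
  using assms subst_iff by metis

lemma Eq_refl: "e (Eq x x)"
  by (rule derivable[OF eq_refl])

lemma Eq_left_cong: "e (Eq x y) \<Longrightarrow> e (Eq x z) \<longleftrightarrow> e (Eq y z)"
  by (erule eq_cong) (simp add: subst_def)

lemma Eq_sym: "e (Eq x y) \<Longrightarrow> e (Eq y x)"
  using Eq_left_cong Eq_refl by blast

text \<open>The variable hidden in \<^const>\<open>Bot\<close> may be replaced too, but on both sides alike.\<close>

lemma Alloc_cong: "e (Eq x y) \<Longrightarrow> e (Alloc x) \<longleftrightarrow> e (Alloc y)"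
  by (erule eq_cong) (simp add: subst_def Alloc_def)

lemma PointsTo_cong:
  assumes "e (Eq x x')" "e (Eq y y')"
  shows "e (PointsTo x y) \<longleftrightarrow> e (PointsTo x' y')"
proof -
  have "e (PointsTo x y) \<longleftrightarrow> e (PointsTo x' y)"
    using assms(1) by (rule eq_cong) (simp add: subst_def)
  also have "\<dots> \<longleftrightarrow> e (PointsTo x' y')"
    using assms(2) by (rule eq_cong) (simp add: subst_def)
  finally show ?thesis .
qed

lemma PointsTo_Alloc: "e (PointsTo x y) \<Longrightarrow> e (Alloc x)"
  using derivable[OF points_to_alloc[of x y]] by simp

lemma PointsTo_functional: "e (PointsTo x y) \<Longrightarrow> e (PointsTo x z) \<Longrightarrow> e (Eq y z)"
  using derivable[OF points_to_functional[of x y z]] by simp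

lemma SizeGe_antimono:
  assumes "m \<le> n" "e (SizeGe n)"
  shows "e (SizeGe m)"
  using assms
proof (induction rule: dec_induct)
  case (step n)
  then show ?case
    using derivable[OF size_mono[of n]] by simp
qed

lemma SizeGe_card:
  assumes "finite X" "\<And>x. x \<in> X \<Longrightarrow> e (Alloc x)"
    and "\<And>x y. x \<in> X \<Longrightarrow> y \<in> X \<Longrightarrow> x \<noteq> y \<Longrightarrow> \<not> e (Eq x y)"
  shows "e (SizeGe (card X))"
proof -
  obtain xs where xs: "set xs = X" "distinct xs"
    using finite_distinct_list[OF assms(1)] by blast
  then have "e (SizeGe (length xs))"
    using derivable[OF alloc_size[OF xs(2)]] assms(2,3) by auto
  then show ?thesis
    using xs distinct_card by metis
qed

end

section \<open>Construction of the store and the heap\<close>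

lemma (in theory_valuation) store_exists:
  fixes f :: "'v \<Rightarrow> 'l"
  assumes "inj f"
  obtains s :: "'v \<Rightarrow> 'l" where "\<And>x y. s x = s y \<longleftrightarrow> e (Eq x y)"
proof -
  \<comment> \<open>The choice depends only on the class of \<open>x\<close>, since equal variables
    have the same predicate under \<open>SOME\<close>; injectivity of \<open>f\<close> keeps
    distinct classes apart.\<close>
  define s where "s x = f (SOME y. e (Eq x y))" for x
  have rep: "e (Eq x (SOME y. e (Eq x y)))" for x
    using Eq_refl by (rule someI)
  have "s x = s y \<longleftrightarrow> e (Eq x y)" for x y
  proof
    assume "s x = s y"
    then have "(SOME z. e (Eq x z)) = (SOME z. e (Eq y z))"
      using assms by (simp add: s_def inj_eq)
    then show "e (Eq x y)"
      using rep[of x] rep[of y] Eq_left_cong Eq_sym by metis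
  next
    assume "e (Eq x y)"
    then have "e (Eq x z) \<longleftrightarrow> e (Eq y z)" for z
      by (rule Eq_left_cong)
    then show "s x = s y"
      by (simp add: s_def)
  qed
  then show ?thesis
    by (rule that)
qed

lemma (in theory_valuation) heap_exists:
  fixes s :: "'v \<Rightarrow> 'l :: infinite"
  assumes s: "\<And>x y. s x = s y \<longleftrightarrow> e (Eq x y)" and "finite V"
  obtains h where "\<And>x. x \<in> V \<Longrightarrow> s x \<in> fmdom' h \<longleftrightarrow> e (Alloc x)"
    "\<And>x y. x \<in> V \<Longrightarrow> y \<in> V \<Longrightarrow> fmlookup h (s x) = Some (s y) \<longleftrightarrow> e (PointsTo x y)"
    "\<And>\<beta>. \<beta> \<le> N \<Longrightarrow> \<beta> \<le> card (fmdom' h) \<longleftrightarrow> e (SizeGe \<beta>)"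
proof -
  define L where "L = s ` {x \<in> V. e (Alloc x)}"
  have "finite L"
    using \<open>finite V\<close> by (simp add: L_def)
  have "e (SizeGe (card L))"
  proof -
    \<comment> \<open>\<open>X\<close> picks one variable per named cell. Its members are pairwise
      unequal under \<open>e\<close>, as \<open>SizeGe_card\<close> demands.\<close>
    have "\<exists>X \<subseteq> {x \<in> V. e (Alloc x)}. inj_on s X \<and> L = s ` X"
      by (simp add: L_def flip: subset_image_inj)
    then obtain X where X: "X \<subseteq> {x \<in> V. e (Alloc x)}" "inj_on s X" "L = s ` X"
      by blast
    have "e (SizeGe (card X))"
    proof (rule SizeGe_card)
      show "finite X"
        using X(1) \<open>finite V\<close> by (auto intro: finite_subset)
    qed (use X s in \<open>auto simp: inj_on_def\<close>)
    then show ?thesis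
      using X by (simp add: card_image)
  qed
  \<comment> \<open>The target size of the heap. The bound is at least \<open>card L\<close>, so
    that the named cells fit even when they outnumber \<open>N\<close>.\<close>
  define n where "n = Max {m. m \<le> max N (card L) \<and> e (SizeGe m)}"
  have fin: "finite {m. m \<le> max N (card L) \<and> e (SizeGe m)}"
    by (rule finite_subset[of _ "{..max N (card L)}"]) auto
  have "n \<in> {m. m \<le> max N (card L) \<and> e (SizeGe m)}"
    unfolding n_def using \<open>e (SizeGe (card L))\<close> by (intro Max_in fin) auto
  then have n: "e (SizeGe n)"
    by simp
  have n_max: "m \<le> n" if "m \<le> max N (card L)" "e (SizeGe m)" for m
    unfolding n_def using that fin by (intro Max_ge) auto
  have "card L \<le> n"
    using n_max \<open>e (SizeGe (card L))\<close> by simp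
  have inf: "infinite (- s ` V)"
    using \<open>finite V\<close> by (simp add: Compl_eq_Diff_UNIV infinite_UNIV)
  \<comment> \<open>\<open>c\<close> is the default content of cells: no variable of
    \<open>V\<close> names it, so it creates no unwanted points-to atom.\<close>
  then obtain c where c: "c \<notin> s ` V"
    by (metis ComplD ex_in_conv finite.emptyI)
  obtain P where P: "finite P" "card P = n - card L" "P \<subseteq> - s ` V"
    using infinite_arbitrarily_large[OF inf] by blast
  \<comment> \<open>The chosen \<open>y\<close> may lie outside \<open>V\<close>. By functionality
    it is equal under \<open>e\<close> to every successor of the cell, so \<open>s y\<close> is
    still the right content.\<close>
  define g where
    "g l = (if \<exists>x\<in>V. \<exists>y\<in>V. s x = l \<and> e (PointsTo x y)
            then s (SOME y. \<exists>x\<in>V. s x = l \<and> e (PointsTo x y)) else c)" for l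
  define h where "h = Abs_fmap (\<lambda>l. if l \<in> L \<union> P then Some (g l) else None)"
  have lookup: "fmlookup h l = (if l \<in> L \<union> P then Some (g l) else None)" for l
    unfolding h_def using \<open>finite L\<close> P(1)
    by (subst Abs_fmap_inverse) (auto intro: finite_subset[of _ "L \<union> P"] split: if_splits)
  then have dom: "fmdom' h = L \<union> P"
    by (auto simp: fmlookup_dom'_iff split: if_splits)
  have in_L: "s x \<in> L \<longleftrightarrow> e (Alloc x)" if "x \<in> V" for x
    using that s Alloc_cong by (auto simp: L_def)
  have g: "g (s x) = s y \<longleftrightarrow> e (PointsTo x y)" if "x \<in> V" "y \<in> V" for x y
  proof (cases "\<exists>x'\<in>V. \<exists>z\<in>V. s x' = s x \<and> e (PointsTo x' z)")
    case True
    \<comment> \<open>The witness belongs to some variable \<open>x'\<close> sharing the location of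
      \<open>x\<close>; congruence transfers it to \<open>x\<close>.\<close>
    define z where "z = (SOME z. \<exists>x'\<in>V. s x' = s x \<and> e (PointsTo x' z))"
    have "\<exists>x'\<in>V. s x' = s x \<and> e (PointsTo x' z)"
      unfolding z_def by (rule someI_ex) (use True in blast)
    then obtain x' where "e (Eq x' x)" "e (PointsTo x' z)"
      using s by auto
    then have "e (PointsTo x z)"
      using PointsTo_cong[OF _ Eq_refl] by blast
    then have "s z = s y \<longleftrightarrow> e (PointsTo x y)"
      unfolding s using PointsTo_cong[OF Eq_refl] PointsTo_functional by blast
    moreover have "g (s x) = s z"
      using True by (simp add: g_def z_def)
    ultimately show ?thesis
      by simp
  next
    case False
    moreover have "\<not> e (PointsTo x y)"
      using False that by blast
    ultimately show ?thesis
      using c that by (auto simp: g_def)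
  qed
  show ?thesis
  proof
    fix x assume "x \<in> V"
    then show "s x \<in> fmdom' h \<longleftrightarrow> e (Alloc x)"
      using P(3) in_L by (auto simp: dom)
    fix y assume "y \<in> V"
    then show "fmlookup h (s x) = Some (s y) \<longleftrightarrow> e (PointsTo x y)"
      using P(3) \<open>x \<in> V\<close> in_L g PointsTo_Alloc by (auto simp: lookup)
  next
    fix \<beta> assume "\<beta> \<le> N"
    have "L \<inter> P = {}"
      using P(3) by (auto simp: L_def)
    then have "card (fmdom' h) = n"
      using \<open>card L \<le> n\<close> \<open>finite L\<close> P by (simp add: dom card_Un_disjoint)
    then show "\<beta> \<le> card (fmdom' h) \<longleftrightarrow> e (SizeGe \<beta>)"
      using \<open>\<beta> \<le> N\<close> n n_max SizeGe_antimono by auto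
  qed
qed

section \<open>Finite bounds on the core formulae involved, and completeness\<close>

inductive core_within :: "'v set \<Rightarrow> nat \<Rightarrow> 'v form \<Rightarrow> bool" for V N where
  "x \<in> V \<Longrightarrow> y \<in> V \<Longrightarrow> core_within V N (Eq x y)"
| "x \<in> V \<Longrightarrow> core_within V N (Alloc x)"
| "x \<in> V \<Longrightarrow> y \<in> V \<Longrightarrow> core_within V N (PointsTo x y)"
| "\<beta> \<le> N \<Longrightarrow> core_within V N (SizeGe \<beta>)"

lemma core_within_mono:
  "core_within V N \<phi> \<Longrightarrow> V \<subseteq> V' \<Longrightarrow> N \<le> N' \<Longrightarrow> core_within V' N' \<phi>"
  by (induction rule: core_within.induct) (auto intro: core_within.intros)

lemma boolean_combination_mono:
  "boolean_combination P \<phi> \<Longrightarrow> (\<And>\<psi>. P \<psi> \<Longrightarrow> Q \<psi>) \<Longrightarrow> boolean_combination Q \<phi>"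
  by (induction rule: boolean_combination.induct) (auto intro: boolean_combination.intros)

text \<open>\<open>heap_exists\<close> matches the valuation only on finitely many variables and up
  to a size bound. A union and a maximum provide common bounds for both sides of a
  conjunction.\<close>

lemma boolean_combination_core_within:
  assumes "boolean_combination core \<phi>"
  obtains V N where "finite V" "boolean_combination (core_within V N) \<phi>"
proof -
  have "\<exists>V N. finite V \<and> boolean_combination (core_within V N) \<phi>"
    using assms
  proof (induction rule: boolean_combination.induct)
    case (1 \<phi>)
    then have "\<exists>V N. finite V \<and> core_within V N \<phi>"
    proof cases
      case (1 x y)
      then show ?thesis
        by (intro exI[of _ "{x, y}"]) (auto intro: core_within.intros)
    next
      case (2 x)
      then show ?thesis
        by (intro exI[of _ "{x}"]) (auto intro: core_within.intros)
    next
      case (3 x y)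
      then show ?thesis
        by (intro exI[of _ "{x, y}"]) (auto intro: core_within.intros)
    next
      case (4 \<beta>)
      then show ?thesis
        by (intro exI[of _ "{}"]) (auto intro: core_within.intros)
    qed
    then show ?case
      by (auto intro: boolean_combination.intros)
  next
    case (2 \<phi>)
    then show ?case
      by (auto intro: boolean_combination.intros)
  next
    case (3 \<phi> \<psi>)
    then obtain V N V' N' where "finite V" "boolean_combination (core_within V N) \<phi>"
        "finite V'" "boolean_combination (core_within V' N') \<psi>"
      by blast
    then have "finite (V \<union> V')" "boolean_combination (core_within (V \<union> V') (max N N')) \<phi>"
        "boolean_combination (core_within (V \<union> V') (max N N')) \<psi>"
      by (auto elim!: boolean_combination_mono core_within_mono)
    then show ?case
      by (auto intro: boolean_combination.intros)
  qed
  then show ?thesis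
    using that by blast
qed

text \<open>The induction stops at core formulae, taken as units although \<open>Alloc\<close> and
  \<open>SizeGe\<close> unfold to spatial connectives, on which \<open>e\<close> need not agree with
  \<open>sat\<close> in general.\<close>

lemma (in theory_valuation) boolean_combination_realised:
  fixes f :: "'v \<Rightarrow> 'l :: infinite"
  assumes "boolean_combination core \<phi>" "inj f"
  obtains s :: "'v \<Rightarrow> 'l" and h where "sat s h \<phi> \<longleftrightarrow> e \<phi>"
proof -
  obtain V N where VN: "finite V" "boolean_combination (core_within V N) \<phi>"
    using boolean_combination_core_within[OF assms(1)] .
  obtain s :: "'v \<Rightarrow> 'l" where s: "\<And>x y. s x = s y \<longleftrightarrow> e (Eq x y)"
    using store_exists[OF assms(2)] by blast
  obtain h where h: "\<And>x. x \<in> V \<Longrightarrow> s x \<in> fmdom' h \<longleftrightarrow> e (Alloc x)"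
    "\<And>x y. x \<in> V \<Longrightarrow> y \<in> V \<Longrightarrow> fmlookup h (s x) = Some (s y) \<longleftrightarrow> e (PointsTo x y)"
    "\<And>\<beta>. \<beta> \<le> N \<Longrightarrow> \<beta> \<le> card (fmdom' h) \<longleftrightarrow> e (SizeGe \<beta>)"
    using heap_exists[OF s VN(1), where N = N] by blast
  have "sat s h \<psi> \<longleftrightarrow> e \<psi>" if "core_within V N \<psi>" for \<psi>
    using that by cases (simp_all add: s h)
  with VN(2) have "sat s h \<phi> \<longleftrightarrow> e \<phi>"
    by (induction rule: boolean_combination.induct) simp_all
  then show ?thesis
    by (rule that)
qed

theorem theorem3p2:
  fixes \<phi> :: "'v :: {countable, infinite} form"
  assumes "boolean_combination core \<phi>"
  shows "valid TYPE('l :: {countable, infinite}) \<phi> \<longleftrightarrow> \<turnstile>\<^sub>C \<phi>"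
proof
  assume valid: "valid TYPE('l) \<phi>"
  \<comment> \<open>Naming classes of variables by locations needs an injection from variables to
    locations; it goes through the naturals.\<close>
  obtain j :: "nat \<Rightarrow> 'l" where "inj j"
    using infinite_countable_subset[OF infinite_UNIV] by blast
  then have inj: "inj (j \<circ> to_nat :: 'v \<Rightarrow> 'l)"
    by (simp add: inj_compose)
  show "\<turnstile>\<^sub>C \<phi>"
  proof (rule derivable_if_theory_valid)
    fix e :: "'v form \<Rightarrow> bool"
    assume "theory_valuation e"
    then obtain s :: "'v \<Rightarrow> 'l" and h where "sat s h \<phi> \<longleftrightarrow> e \<phi>"
      using theory_valuation.boolean_combination_realised[OF _ assms inj] by blast
    with valid show "e \<phi>"
      by (simp add: valid_def)
  qed
next
  assume "\<turnstile>\<^sub>C \<phi>"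
  then show "valid TYPE('l) \<phi>"
    by (simp add: valid_def derivable_sound)
qed

end
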